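(* Let $k\ge 1$ be an integer, and for $1\le i\le k$ define $\gamma_i^k$ by $$2^{2i}\gamma_i^k:=2\binom{2k}{2i}-2\binom{k}{i}+\binom{k}{i-1}.$$ Then the constants $\gamma_i^k$ are non-negative, and for every finitely supported function $u:\mathbb{Z}\to\mathbb{C}$ with $u(0)=0$, $$\sum_{n\in\mathbb{Z}}|u(n)-u(n-1)|^2\Big(n-\frac12\Big)^{2k}\;\ge\;\sum_{i=1}^k\gamma_i^k\sum_{n\in\mathbb{Z}}|u(n)|^2 n^{2k-2i}+2^{-2k-2}\sum_{n\in\mathbb{Z}\setminus\{0\}}\frac{|u(n)|^2}{n^2}.$$
   Context: $\binom{n}{k}$ is the usual binomial coefficient. The convention $n^0=1$ is used (irrelevant at $n=0$ since $u(0)=0$). *)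

theory Defs
  imports "HOL-Analysis.Analysis"
begin

text \<open>Only the range \<open>1 \<le> i \<le> k\<close> is meaningful. The binomial coefficients are cast to the reals
  individually, so the subtraction is not truncated.\<close>

definition hardy_gamma :: "nat \<Rightarrow> nat \<Rightarrow> real" where
  "hardy_gamma k i =
     (2 * real ((2 * k) choose (2 * i)) - 2 * real (k choose i) + real (k choose (i - 1))) / 2 ^ (2 * i)"

end

theory Submission
  imports Defs
begin

text \<open>
  With \<open>V\<^sub>n = (n - 1/2)\<^bsup>2k\<^esup>\<close> and \<open>W\<^sub>n = (n\<^sup>2 + 1/4)\<^bsup>k\<^esup>\<close>, the weight multiplying \<open>|u(n)|\<^sup>2\<close> on the
  right-hand side is exactly \<open>V\<^sub>n + V\<^sub>n\<^sub>+\<^sub>1 - W\<^sub>n (2 - 1/(4n\<^sup>2))\<close>. Expanding the square on the left reduces the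
  inequality to a bound on the cross terms \<open>2 V\<^sub>n |u(n)| |u(n-1)|\<close>. Since
  \<open>W\<^sub>n W\<^sub>n\<^sub>-\<^sub>1 = ((n - 1/2)\<^sup>4 + 1/4)\<^bsup>k\<^esup> \<ge> V\<^sub>n\<^sup>2\<close>, substituting \<open>v(n) = W\<^sub>n\<^bsup>1/2\<^esup> |u(n)|\<close> leaves the
  classical discrete Hardy inequality for \<open>v\<close>, which follows from the positive supersolution
  \<open>\<phi>(n) = |n|\<^bsup>1/2\<^esup>\<close>. The non-negativity of the constants is Vandermonde's identity.
\<close>

text \<open>The term \<open>j = i\<close> in Vandermonde's sum for the right-hand side is the square
  of \<open>k choose i\<close>, and a natural number is at most its square.\<close>

lemma binomial_le_binomial_double: "(k choose i) \<le> ((2 * k) choose (2 * i))"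
proof -
  have "(k choose i) \<le> (k choose i) * (k choose i)"
    by (cases "k choose i") auto
  also have "\<dots> = (k choose i) * (k choose (2 * i - i))"
    by simp
  also have "\<dots> \<le> (\<Sum>j\<le>2 * i. (k choose j) * (k choose (2 * i - j)))"
    by (rule member_le_sum) auto
  also have "\<dots> = (2 * k) choose (2 * i)"
    using vandermonde[of k k "2 * i"] by (simp add: mult_2)
  finally show ?thesis .
qed

lemma hardy_gamma_nonneg: "hardy_gamma k i \<ge> 0"
proof -
  have "real (k choose i) \<le> real ((2 * k) choose (2 * i))"
    using binomial_le_binomial_double by simp
  then show ?thesis
    by (simp add: hardy_gamma_def)
qed

text \<open>Adding the two expansions puts the factor \<open>h ^ j + (- h) ^ j\<close> in the term
  of index \<open>j\<close>: odd indices cancel and even ones double.\<close>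

lemma binomial_even_part:
  fixes x h :: real
  shows "(x + h) ^ (2 * k) + (x - h) ^ (2 * k) =
    (\<Sum>i\<le>k. 2 * real ((2 * k) choose (2 * i)) * h ^ (2 * i) * x ^ (2 * k - 2 * i))"
proof -
  define f where "f j = real ((2 * k) choose j) * x ^ (2 * k - j) * (h ^ j + (- h) ^ j)" for j
  have "(x + h) ^ (2 * k) + (x - h) ^ (2 * k) = (h + x) ^ (2 * k) + (- h + x) ^ (2 * k)"
    by (simp add: add.commute)
  also have "\<dots> = (\<Sum>j\<le>2 * k. f j)"
    unfolding binomial_ring f_def by (simp add: sum.distrib[symmetric] algebra_simps)
  also have "\<dots> = (\<Sum>j\<in>(\<lambda>i. 2 * i) ` {..k}. f j)"
  proof (rule sum.mono_neutral_right)
    show "\<forall>j\<in>{..2 * k} - (\<lambda>i. 2 * i) ` {..k}. f j = 0"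
    proof
      fix j assume j: "j \<in> {..2 * k} - (\<lambda>i. 2 * i) ` {..k}"
      then have "odd j"
        by (auto elim!: evenE)
      then show "f j = 0"
        by (simp add: f_def)
    qed
  qed auto
  also have "\<dots> = (\<Sum>i\<le>k. f (2 * i))"
    by (subst sum.reindex) (auto simp: inj_on_def)
  also have "\<dots> = (\<Sum>i\<le>k. 2 * real ((2 * k) choose (2 * i)) * h ^ (2 * i) * x ^ (2 * k - 2 * i))"
    by (rule sum.cong) (auto simp: f_def)
  finally show ?thesis .
qed

text \<open>The three binomials in \<open>hardy_gamma\<close> have separate sources:
  \<open>e\<close> is the even part of the two shifted powers, \<open>c\<close> expands
  \<open>W\<close>, and \<open>d\<close> expands \<open>W / (4 * x^2)\<close> with its index raised
  by one.\<close>

lemma hardy_weight_closed_form: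
  fixes x :: real
  assumes "x \<noteq> 0"
  shows "(\<Sum>i = 1..k. hardy_gamma k i * x ^ (2 * k - 2 * i)) + 1 / 2 ^ (2 * k + 2) / x\<^sup>2 =
    (x + 1 / 2) ^ (2 * k) + (x - 1 / 2) ^ (2 * k) - (x\<^sup>2 + 1 / 4) ^ k * (2 - 1 / (4 * x\<^sup>2))"
proof -
  define W where "W = (x\<^sup>2 + 1 / 4) ^ k"
  define c where "c i = real (k choose i) * x ^ (2 * k - 2 * i) / 2 ^ (2 * i)" for i
  define d where "d i = real (k choose (i - 1)) * x ^ (2 * k - 2 * i) / 2 ^ (2 * i)" for i
  define e where "e i = 2 * real ((2 * k) choose (2 * i)) * x ^ (2 * k - 2 * i) / 2 ^ (2 * i)" for i
  have "W = (\<Sum>i\<le>k. real (k choose i) * (1 / 4) ^ i * (x\<^sup>2) ^ (k - i))"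
    unfolding W_def by (subst add.commute) (simp add: binomial_ring)
  also have "\<dots> = (\<Sum>i\<le>k. c i)"
    by (rule sum.cong) (auto simp: c_def power_mult power_one_over diff_mult_distrib2[symmetric])
  finally have W: "W = (\<Sum>i\<le>k. c i)" .
  have E: "(x + 1 / 2) ^ (2 * k) + (x - 1 / 2) ^ (2 * k) = (\<Sum>i\<le>k. e i)"
    unfolding binomial_even_part e_def by (rule sum.cong) (auto simp: power_one_over)
  have split: "sum g {..k} = g 0 + sum g {1..k}" for g :: "nat \<Rightarrow> real"
    by (simp add: atMost_atLeast0 sum.atLeast_Suc_atMost)
  \<comment> \<open>The top index is split off because dividing \<open>c k\<close> by
    \<open>4 * x^2\<close> leaves the negative power \<open>1 / x^2\<close>. This is the extra Hardy
    term; all other terms become \<open>d (Suc i)\<close>.\<close>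
  have "W / (4 * x\<^sup>2) = (\<Sum>i<k. c i / (4 * x\<^sup>2)) + c k / (4 * x\<^sup>2)"
    unfolding W by (simp add: sum_divide_distrib add_divide_distrib lessThan_Suc_atMost[symmetric])
  also have "(\<Sum>i<k. c i / (4 * x\<^sup>2)) = (\<Sum>i<k. d (Suc i))"
  proof (rule sum.cong)
    fix i assume "i \<in> {..<k}"
    then have "2 * k - 2 * i = (2 * k - 2 * Suc i) + 2"
      by auto
    then have "x ^ (2 * k - 2 * i) = x ^ (2 * k - 2 * Suc i) * x\<^sup>2"
      by (metis power_add)
    then show "c i / (4 * x\<^sup>2) = d (Suc i)"
      using assms by (simp add: c_def d_def field_simps)
  qed simp
  also have "\<dots> = (\<Sum>i = 1..k. d i)"
    by (simp add: sum.atLeast1_atMost_eq)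
  also have "c k / (4 * x\<^sup>2) = 1 / 2 ^ (2 * k + 2) / x\<^sup>2"
    by (simp add: c_def)
  finally have D: "W / (4 * x\<^sup>2) = (\<Sum>i = 1..k. d i) + 1 / 2 ^ (2 * k + 2) / x\<^sup>2" .
  have "(\<Sum>i = 1..k. hardy_gamma k i * x ^ (2 * k - 2 * i)) = (\<Sum>i = 1..k. e i - 2 * c i + d i)"
    by (rule sum.cong) (auto simp: hardy_gamma_def c_def d_def e_def field_simps)
  also have "\<dots> = (\<Sum>i = 1..k. e i) - 2 * (\<Sum>i = 1..k. c i) + (\<Sum>i = 1..k. d i)"
    by (simp add: sum.distrib sum_subtractf sum_distrib_left)
  \<comment> \<open>Index 0 can be added for free, since \<open>e 0 = 2 * c 0\<close>.\<close>
  also have "\<dots> = (\<Sum>i\<le>k. e i) - 2 * W + (\<Sum>i = 1..k. d i)"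
    unfolding W split by (simp add: c_def e_def)
  finally show ?thesis
    unfolding E[symmetric] W_def[symmetric] using D by (simp add: right_diff_distrib)
qed

text \<open>This is the supersolution property of the square root, obtained by squaring the sum
  \<open>p + q\<close> of the two ratios. With \<open>y = 1 / x^2\<close>,
  \<open>p^2 + q^2 = 2\<close> and \<open>p * q = sqrt (1 - y)\<close>, so \<open>(p + q)^2\<close>
  is at most \<open>4 - y\<close>, hence at most \<open>(2 - y / 4)^2\<close>.\<close>

lemma sqrt_neighbours_le:
  fixes x :: real
  assumes "\<bar>x\<bar> \<ge> 1"
  shows "sqrt \<bar>x - 1\<bar> / sqrt \<bar>x\<bar> + sqrt \<bar>x + 1\<bar> / sqrt \<bar>x\<bar> \<le> 2 - 1 / (4 * x\<^sup>2)"
proof -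
  define y where "y = 1 / x\<^sup>2"
  have x2: "x\<^sup>2 \<ge> 1"
    using assms by (simp add: abs_le_square_iff[of 1, simplified])
  then have y: "0 \<le> y" "y \<le> 1"
    by (auto simp: y_def divide_le_eq_1)
  define p where "p = sqrt \<bar>x - 1\<bar> / sqrt \<bar>x\<bar>"
  define q where "q = sqrt \<bar>x + 1\<bar> / sqrt \<bar>x\<bar>"
  have sq: "p\<^sup>2 + q\<^sup>2 = 2"
    using assms by (auto simp: p_def q_def power_divide abs_if field_simps split: if_splits)
  have "p * q = sqrt (\<bar>x - 1\<bar> * \<bar>x + 1\<bar> / (\<bar>x\<bar> * \<bar>x\<bar>))"
    by (simp add: p_def q_def real_sqrt_mult real_sqrt_divide)
  also have "\<bar>x - 1\<bar> * \<bar>x + 1\<bar> / (\<bar>x\<bar> * \<bar>x\<bar>) = 1 - y"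
  proof -
    have "\<bar>x - 1\<bar> * \<bar>x + 1\<bar> = x\<^sup>2 - 1"
      using x2 by (simp add: abs_mult[symmetric] algebra_simps power2_eq_square)
    then show ?thesis
      using x2 by (auto simp: y_def power2_eq_square diff_divide_distrib)
  qed
  also have "sqrt (1 - y) \<le> 1 - y / 2"
  proof (rule real_le_lsqrt)
    show "1 - y \<le> (1 - y / 2)\<^sup>2"
      by (simp add: power2_eq_square field_simps)
  qed (use y in auto)
  finally have pq: "p * q \<le> 1 - y / 2" .
  have "(p + q)\<^sup>2 \<le> 2 + 2 * (1 - y / 2)"
    using sq pq by (simp add: power2_sum)
  also have "\<dots> \<le> (2 - y / 4)\<^sup>2"
    by (simp add: power2_eq_square algebra_simps)
  finally have "p + q \<le> 2 - y / 4"
    by (rule power2_le_imp_le) (use y in auto)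
  then show ?thesis
    by (simp add: p_def q_def y_def)
qed

text \<open>With \<open>s = t - 1/2\<close> the two bases on the right are
  \<open>s^2 + s + 1/2\<close> and \<open>s^2 - s + 1/2\<close>, the Sophie Germain factors of
  \<open>s^4 + 1/4\<close>.\<close>

lemma shifted_power_le_geometric_mean:
  fixes t :: real
  shows "(t - 1 / 2) ^ (2 * k) \<le> sqrt ((t\<^sup>2 + 1 / 4) ^ k) * sqrt (((t - 1)\<^sup>2 + 1 / 4) ^ k)"
proof -
  have "((t - 1 / 2)\<^sup>2)\<^sup>2 \<le> (t\<^sup>2 + 1 / 4) * ((t - 1)\<^sup>2 + 1 / 4)"
    by (simp add: power2_eq_square algebra_simps)
  then have "(((t - 1 / 2)\<^sup>2)\<^sup>2) ^ k \<le> ((t\<^sup>2 + 1 / 4) * ((t - 1)\<^sup>2 + 1 / 4)) ^ k"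
    by (rule power_mono) simp
  then have "((t - 1 / 2) ^ (2 * k))\<^sup>2 \<le> (t\<^sup>2 + 1 / 4) ^ k * ((t - 1)\<^sup>2 + 1 / 4) ^ k"
    by (simp add: power_mult_distrib power_mult[symmetric] mult.commute mult.left_commute)
  then show ?thesis
    unfolding real_sqrt_mult[symmetric] by (rule real_le_rsqrt)
qed

text \<open>For positive weights the gap is \<open>(q * a - p * b)^2 / (p * q)\<close>. The last two
  assumptions admit a zero weight, which occurs on the edges at the origin.\<close>

lemma two_mult_le_weighted_squares:
  fixes a b p q :: real
  assumes "0 \<le> p" "0 \<le> q" "p = 0 \<Longrightarrow> a = 0" "q = 0 \<Longrightarrow> b = 0"
  shows "2 * (a * b) \<le> q / p * a\<^sup>2 + p / q * b\<^sup>2"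
proof (cases "p = 0 \<or> q = 0")
  case True
  then show ?thesis
    using assms by auto
next
  case False
  then have pq: "p > 0" "q > 0"
    using assms by auto
  have "q / p * a\<^sup>2 + p / q * b\<^sup>2 - 2 * (a * b) = (q * a - p * b)\<^sup>2 / (p * q)"
    using pq by (simp add: field_simps power2_eq_square)
  also have "\<dots> \<ge> 0"
    using pq by simp
  finally show ?thesis
    by simp
qed

lemma cmod_diff_squared_ge: "(cmod (z - w))\<^sup>2 \<ge> (cmod z)\<^sup>2 + (cmod w)\<^sup>2 - 2 * (cmod z * cmod w)"
proof -
  have "(cmod z - cmod w)\<^sup>2 \<le> (cmod (z - w))\<^sup>2"
    by (metis norm_triangle_ineq3 power2_abs abs_ge_zero power_mono)
  then show ?thesis
    by (simp add: power2_diff algebra_simps)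
qed

text \<open>Removes the cross term from a single edge, leaving one diagonal contribution at each
  endpoint.\<close>

lemma edge_energy_ge:
  fixes u :: "int \<Rightarrow> complex" and n :: int and k :: nat
  assumes "u 0 = 0"
  defines "W \<equiv> \<lambda>m::int. ((real_of_int m)\<^sup>2 + 1 / 4) ^ k"
    and "\<phi> \<equiv> \<lambda>m::int. sqrt \<bar>real_of_int m\<bar>"
  shows "(cmod (u n - u (n - 1)))\<^sup>2 * (real_of_int n - 1 / 2) ^ (2 * k) \<ge>
     ((real_of_int n - 1 / 2) ^ (2 * k) - \<phi> (n - 1) / \<phi> n * W n) * (cmod (u n))\<^sup>2
   + ((real_of_int n - 1 / 2) ^ (2 * k) - \<phi> n / \<phi> (n - 1) * W (n - 1)) * (cmod (u (n - 1)))\<^sup>2"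
proof -
  define V where "V = (real_of_int n - 1 / 2) ^ (2 * k)"
  define a where "a = cmod (u n)"
  define b where "b = cmod (u (n - 1))"
  have W0: "W m \<ge> 0" for m
    by (simp add: W_def)
  have V0: "V \<ge> 0"
    by (simp add: V_def power_mult)
  have "V \<le> sqrt (W n) * sqrt (W (n - 1))"
    using shifted_power_le_geometric_mean[of "real_of_int n" k] by (simp add: V_def W_def)
  then have "V * (a * b) \<le> sqrt (W n) * sqrt (W (n - 1)) * (a * b)"
    by (rule mult_right_mono) (simp add: a_def b_def)
  then have "2 * (V * (a * b)) \<le> 2 * ((sqrt (W n) * a) * (sqrt (W (n - 1)) * b))"
    by (simp add: algebra_simps)
  \<comment> \<open>The weights are the values of \<phi> at the endpoints; \<phi> vanishes only at
    the origin, where \<open>u\<close> does too.\<close>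
  also have "\<dots> \<le> \<phi> (n - 1) / \<phi> n * (sqrt (W n) * a)\<^sup>2 + \<phi> n / \<phi> (n - 1) * (sqrt (W (n - 1)) * b)\<^sup>2"
    by (rule two_mult_le_weighted_squares) (use assms(1) in \<open>auto simp: \<phi>_def a_def b_def\<close>)
  also have "\<dots> = \<phi> (n - 1) / \<phi> n * W n * a\<^sup>2 + \<phi> n / \<phi> (n - 1) * W (n - 1) * b\<^sup>2"
    using W0 by (simp add: power_mult_distrib)
  finally have cross: "2 * (V * (a * b)) \<le> \<dots>" .
  have "(a\<^sup>2 + b\<^sup>2 - 2 * (a * b)) * V \<le> (cmod (u n - u (n - 1)))\<^sup>2 * V"
    unfolding a_def b_def by (rule mult_right_mono[OF cmod_diff_squared_ge V0])
  with cross show ?thesis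
    unfolding V_def[symmetric] a_def[symmetric] b_def[symmetric] by (simp add: algebra_simps)
qed

lemma summable_on_finite_support:
  fixes f g :: "'a \<Rightarrow> real"
  assumes "finite {x. g x \<noteq> 0}" "\<And>x. g x = 0 \<Longrightarrow> f x = 0"
  shows "f summable_on A"
proof (rule finite_nonzero_values_imp_summable_on)
  show "finite {x \<in> A. f x \<noteq> 0}"
    by (rule finite_subset[OF _ assms(1)]) (use assms(2) in auto)
qed

lemma has_sum_finite_sum:
  fixes f :: "'i \<Rightarrow> 'a \<Rightarrow> 'b :: topological_comm_monoid_add"
  assumes "finite I" "\<And>i. i \<in> I \<Longrightarrow> (f i has_sum s i) A"
  shows "((\<lambda>x. \<Sum>i\<in>I. f i x) has_sum (\<Sum>i\<in>I. s i)) A"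
  using assms by (induction I rule: finite_induct) (auto intro!: has_sum_add)

lemma power_weighted_hardy:
  fixes u :: "int \<Rightarrow> complex"
  assumes fin: "finite {n. u n \<noteq> 0}" and u0: "u 0 = 0"
  shows "(\<Sum>i = 1..k. hardy_gamma k i * (\<Sum>\<^sub>\<infinity>n\<in>UNIV. (cmod (u n))\<^sup>2 * real_of_int n ^ (2 * k - 2 * i)))
         + 1 / 2 ^ (2 * k + 2) * (\<Sum>\<^sub>\<infinity>n\<in>UNIV - {0}. (cmod (u n))\<^sup>2 / (real_of_int n)\<^sup>2)
      \<le> (\<Sum>\<^sub>\<infinity>n\<in>UNIV. (cmod (u n - u (n - 1)))\<^sup>2 * (real_of_int n - 1 / 2) ^ (2 * k))"
proof -
  define W where "W m = ((real_of_int m)\<^sup>2 + 1 / 4) ^ k" for m :: int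
  define \<phi> where "\<phi> m = sqrt \<bar>real_of_int m\<bar>" for m :: int
  \<comment> \<open>\<open>a n\<close> and \<open>b n\<close> are the shares that the vertex
    \<open>n\<close> receives from its left and right edges; the second endpoint term of edge
    \<open>n\<close> is thus \<open>b (n - 1)\<close>.\<close>
  define a where "a n = ((real_of_int n - 1 / 2) ^ (2 * k) - \<phi> (n - 1) / \<phi> n * W n) * (cmod (u n))\<^sup>2" for n
  define b where "b n = ((real_of_int n + 1 / 2) ^ (2 * k) - \<phi> (n + 1) / \<phi> n * W n) * (cmod (u n))\<^sup>2" for n
  define r where "r i n = (cmod (u n))\<^sup>2 * real_of_int n ^ (2 * k - 2 * i)" for i and n :: int
  define s where "s n = (cmod (u n))\<^sup>2 / (real_of_int n)\<^sup>2" for n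
  have fin': "finite {n. cmod (u n) \<noteq> 0}"
    using fin by simp
  note summable = summable_on_finite_support[OF fin']
  have finb: "finite {n. cmod (u (n - 1)) \<noteq> 0}"
  proof -
    have "{n. cmod (u (n - 1)) \<noteq> 0} \<subseteq> (\<lambda>n. n + 1) ` {n. u n \<noteq> 0}"
      by (auto intro!: image_eqI[where x = "_ - 1"])
    with fin show ?thesis
      by (meson finite_imageI finite_subset)
  qed
  have summ_energy: "(\<lambda>n. (cmod (u n - u (n - 1)))\<^sup>2 * (real_of_int n - 1 / 2) ^ (2 * k)) summable_on UNIV"
  \<comment> \<open>An edge contributes only if one of its endpoints lies in the support, so
    \<open>g\<close> is the indicator of the union of the support and its shift.\<close>
  proof (rule summable_on_finite_support[where g = "\<lambda>n. if u n = 0 \<and> u (n - 1) = 0 then 0 else 1"])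
    show "finite {n. (if u n = 0 \<and> u (n - 1) = 0 then 0 else 1 :: real) \<noteq> 0}"
      by (rule finite_subset[OF _ finite_UnI[OF fin finb]]) auto
  qed (auto split: if_splits)
  have summ_a: "a summable_on UNIV" and summ_b: "b summable_on UNIV"
    and summ_r: "\<And>i. r i summable_on UNIV" and summ_s: "s summable_on UNIV"
    by (auto intro!: summable simp: a_def b_def r_def s_def)
  have summ_b': "(\<lambda>n. b (n - 1)) summable_on UNIV"
    by (rule summable_on_finite_support[OF finb]) (simp add: b_def)
  have pointwise: "(\<Sum>i = 1..k. hardy_gamma k i * r i n) + 1 / 2 ^ (2 * k + 2) * s n \<le> a n + b n" for n
  proof (cases "n = 0")
    case True
    then show ?thesis
      using u0 by (simp add: a_def b_def r_def s_def)
  next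
    case False
    define x where "x = real_of_int n"
    have x: "x \<noteq> 0" "\<bar>x\<bar> \<ge> 1"
      using False by (auto simp: x_def)
    \<comment> \<open>Scaled by \<open>W n\<close>, the supersolution bound is exactly the loss
      allowed by the closed form of the weight.\<close>
    have "(\<phi> (n - 1) / \<phi> n + \<phi> (n + 1) / \<phi> n) * W n \<le> (2 - 1 / (4 * x\<^sup>2)) * W n"
      using sqrt_neighbours_le[OF x(2)]
      by (intro mult_right_mono) (auto simp: \<phi>_def x_def W_def)
    then have "(\<Sum>i = 1..k. hardy_gamma k i * x ^ (2 * k - 2 * i)) + 1 / 2 ^ (2 * k + 2) / x\<^sup>2
        \<le> (x - 1 / 2) ^ (2 * k) - \<phi> (n - 1) / \<phi> n * W n + ((x + 1 / 2) ^ (2 * k) - \<phi> (n + 1) / \<phi> n * W n)"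
      unfolding hardy_weight_closed_form[OF x(1)] W_def x_def[symmetric] by (simp add: algebra_simps)
    then have "((\<Sum>i = 1..k. hardy_gamma k i * x ^ (2 * k - 2 * i)) + 1 / 2 ^ (2 * k + 2) / x\<^sup>2) * (cmod (u n))\<^sup>2
        \<le> ((x - 1 / 2) ^ (2 * k) - \<phi> (n - 1) / \<phi> n * W n + ((x + 1 / 2) ^ (2 * k) - \<phi> (n + 1) / \<phi> n * W n)) * (cmod (u n))\<^sup>2"
      by (rule mult_right_mono) simp
    then show ?thesis
      unfolding a_def b_def r_def s_def x_def[symmetric]
      by (simp add: distrib_right distrib_left sum_distrib_right sum_distrib_left mult_ac)
  qed
  have weights: "((\<lambda>n. (\<Sum>i = 1..k. hardy_gamma k i * r i n) + 1 / 2 ^ (2 * k + 2) * s n) has_sum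
      (\<Sum>i = 1..k. hardy_gamma k i * infsum (r i) UNIV) + 1 / 2 ^ (2 * k + 2) * infsum s UNIV) UNIV"
    by (intro has_sum_add has_sum_finite_sum has_sum_cmult_right has_sum_infsum summ_r summ_s) simp
  \<comment> \<open>Restoring the origin changes nothing: division by zero makes
    \<open>s 0 = 0\<close>.\<close>
  have "infsum s (UNIV - {0}) = infsum s UNIV"
    by (rule infsum_cong_neutral) (auto simp: s_def)
  then have "(\<Sum>i = 1..k. hardy_gamma k i * infsum (r i) UNIV) + 1 / 2 ^ (2 * k + 2) * infsum s (UNIV - {0})
      = (\<Sum>\<^sub>\<infinity>n. (\<Sum>i = 1..k. hardy_gamma k i * r i n) + 1 / 2 ^ (2 * k + 2) * s n)"
    using infsumI[OF weights] by simp
  also have "\<dots> \<le> (\<Sum>\<^sub>\<infinity>n. a n + b n)"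
    by (intro infsum_mono pointwise has_sum_imp_summable[OF weights] summable_on_add summ_a summ_b)
  also have "\<dots> = infsum a UNIV + infsum b UNIV"
    by (rule infsum_add[OF summ_a summ_b])
  \<comment> \<open>The shift regroups the sum from vertices to edges, so that the edge bound
    applies termwise.\<close>
  also have "infsum b UNIV = (\<Sum>\<^sub>\<infinity>n. b (n - 1))"
    by (rule infsum_reindex_bij_betw[symmetric], rule bij_betwI[where g = "\<lambda>n. n + 1"]) auto
  also have "infsum a UNIV + \<dots> = (\<Sum>\<^sub>\<infinity>n. a n + b (n - 1))"
    by (rule infsum_add[OF summ_a summ_b', symmetric])
  also have "\<dots> \<le> (\<Sum>\<^sub>\<infinity>n. (cmod (u n - u (n - 1)))\<^sup>2 * (real_of_int n - 1 / 2) ^ (2 * k))"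
  proof (rule infsum_mono)
    show "a n + b (n - 1) \<le> (cmod (u n - u (n - 1)))\<^sup>2 * (real_of_int n - 1 / 2) ^ (2 * k)" for n
      using edge_energy_ge[of u n k, OF u0] by (simp add: a_def b_def W_def \<phi>_def)
  qed (auto intro!: summable_on_add summ_a summ_b' summ_energy)
  finally show ?thesis
    unfolding r_def s_def .
qed

theorem theorem2p2:
  fixes k :: nat
  assumes "k \<ge> 1"
  shows "(\<forall>i\<in>{1..k}. hardy_gamma k i \<ge> 0) \<and>
    (\<forall>u :: int \<Rightarrow> complex. finite {n. u n \<noteq> 0} \<longrightarrow> u 0 = 0 \<longrightarrow>
      (\<Sum>\<^sub>\<infinity>n\<in>UNIV. (cmod (u n - u (n - 1)))\<^sup>2 * (real_of_int n - 1 / 2) ^ (2 * k))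
      \<ge> (\<Sum>i = 1..k. hardy_gamma k i * (\<Sum>\<^sub>\<infinity>n\<in>UNIV. (cmod (u n))\<^sup>2 * real_of_int n ^ (2 * k - 2 * i)))
         + 1 / 2 ^ (2 * k + 2) * (\<Sum>\<^sub>\<infinity>n\<in>UNIV - {0}. (cmod (u n))\<^sup>2 / (real_of_int n)\<^sup>2))"
  using hardy_gamma_nonneg power_weighted_hardy by blast

end
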